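(* Let $Z=(U,\Omega,r)$ be a non-degenerate multimatroid and let $\prec$ be a total ordering of its skew classes. Then for each transversal $T$ of $\Omega$, the number of bases $B$ of $Z$ with $T\in H_Z(B)$ is exactly $\prod_{\omega \in \mathrm{mcs}(T,\prec)} (|\omega|-1)$.
   Context: A carrier is a pair $(U,\Omega)$ with $U$ finite and $\Omega$ a partition of $U$ into non-empty skew classes. A subtransversal meets each skew class at most once; a transversal meets each exactly once; a skew pair is two distinct elements of one skew class. A multimatroid $Z=(U,\Omega,r)$ has a non-negative integer function $r$ on subtransversals with (R1) for every transversal $T$, $r$ restricted to subsets of $T$ is a matroid rank function; (R2) for every subtransversal $S$ and skew pair $\{x,y\}$ in a skew class disjoint from $S$, $r(S\cup\{x\})+r(S\cup\{y\})-2r(S)\ge1$. $n(S)=|S|-r(S)$; independent means $n(S)=0$; bases are maximal independent subtransversals; circuits are minimal dependent subtransversals. Non-degenerate: all skew classes have size at least 2 (then bases are transversals). $S_\omega$ is the element of $S\cap\omega$. For a basis $B$ and skew class $\omega$, $B\cup\omega$ contains at most one circuit, the fundamental circuit $C(B,\omega)$ when it exists, and $\underline B_\omega$ is the unique element of $C(B,\omega)-B$. The ordering $\prec$ of skew classes induces an order on elements of any subtransversal; $\min(S)$ is the least element. $\omega$ is active with respect to basis $B$ if $C(B,\omega)$ exists and $\min(C(B,\omega))\in\omega$; $\mathrm{act}_\prec(B)$ is the set of active skew classes. Let $B_{\mathrm{int}}=\{B_\omega:\omega\in\mathrm{act}_\prec(B)\}$, $B_{\mathrm{ext}}=\{\underline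 B_\omega:\omega\in\mathrm{act}_\prec(B)\}$ and $H_Z(B)=\{T \text{ transversal}: B-B_{\mathrm{int}}\subseteq T\subseteq B\cup B_{\mathrm{ext}}\}$. For a subtransversal $S$, $\mathrm{mce}(S,\prec)=\{\min(C): C\subseteq S,\ C \text{ a circuit of } Z\}$ and $\mathrm{mcs}(S,\prec)$ is the set of skew classes meeting $\mathrm{mce}(S,\prec)$. *)

theory Defs
  imports "HOL-Library.Disjoint_Sets"
begin

definition is_carrier :: "'a set \<Rightarrow> 'a set set \<Rightarrow> bool" where
  "is_carrier U \<Omega> \<longleftrightarrow> finite U \<and> partition_on U \<Omega>"

definition subtransversal :: "'a set \<Rightarrow> 'a set set \<Rightarrow> 'a set \<Rightarrow> bool" where
  "subtransversal U \<Omega> S \<longleftrightarrow> S \<subseteq> U \<and> (\<forall>\<omega>\<in>\<Omega>. card (S \<inter> \<omega>) \<le> 1)"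

definition transversal :: "'a set \<Rightarrow> 'a set set \<Rightarrow> 'a set \<Rightarrow> bool" where
  "transversal U \<Omega> T \<longleftrightarrow> T \<subseteq> U \<and> (\<forall>\<omega>\<in>\<Omega>. card (T \<inter> \<omega>) = 1)"

definition matroid_rank_on :: "'a set \<Rightarrow> ('a set \<Rightarrow> nat) \<Rightarrow> bool" where
  "matroid_rank_on E r \<longleftrightarrow>
     finite E \<and>
     (\<forall>X. X \<subseteq> E \<longrightarrow> r X \<le> card X) \<and>
     (\<forall>X Y. X \<subseteq> Y \<and> Y \<subseteq> E \<longrightarrow> r X \<le> r Y) \<and>
     (\<forall>X Y. X \<subseteq> E \<and> Y \<subseteq> E \<longrightarrow> r (X \<union> Y) + r (X \<inter> Y) \<le> r X + r Y)"

text \<open>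
  The rank function is a total function on sets, but only its values on subtransversals
  are constrained or used.
\<close>

definition multimatroid :: "'a set \<Rightarrow> 'a set set \<Rightarrow> ('a set \<Rightarrow> nat) \<Rightarrow> bool" where
  "multimatroid U \<Omega> r \<longleftrightarrow>
     is_carrier U \<Omega> \<and>
     (\<forall>T. transversal U \<Omega> T \<longrightarrow> matroid_rank_on T r) \<and>
     (\<forall>S \<omega> x y. subtransversal U \<Omega> S \<and> \<omega> \<in> \<Omega> \<and> \<omega> \<inter> S = {} \<and> x \<in> \<omega> \<and> y \<in> \<omega> \<and> x \<noteq> y \<longrightarrow>
        int (r (S \<union> {x})) + int (r (S \<union> {y})) - 2 * int (r S) \<ge> 1)"

definition non_degenerate :: "'a set set \<Rightarrow> bool" where
  "non_degenerate \<Omega> \<longleftrightarrow> (\<forall>\<omega>\<in>\<Omega>. card \<omega> \<ge> 2)"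

definition nullity :: "('a set \<Rightarrow> nat) \<Rightarrow> 'a set \<Rightarrow> int" where
  "nullity r S = int (card S) - int (r S)"

definition indep :: "'a set \<Rightarrow> 'a set set \<Rightarrow> ('a set \<Rightarrow> nat) \<Rightarrow> 'a set \<Rightarrow> bool" where
  "indep U \<Omega> r S \<longleftrightarrow> subtransversal U \<Omega> S \<and> nullity r S = 0"

definition dependent :: "'a set \<Rightarrow> 'a set set \<Rightarrow> ('a set \<Rightarrow> nat) \<Rightarrow> 'a set \<Rightarrow> bool" where
  "dependent U \<Omega> r S \<longleftrightarrow> subtransversal U \<Omega> S \<and> nullity r S \<noteq> 0"

definition basis :: "'a set \<Rightarrow> 'a set set \<Rightarrow> ('a set \<Rightarrow> nat) \<Rightarrow> 'a set \<Rightarrow> bool" where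
  "basis U \<Omega> r B \<longleftrightarrow> indep U \<Omega> r B \<and> (\<forall>S. indep U \<Omega> r S \<and> B \<subseteq> S \<longrightarrow> S = B)"

definition circuit :: "'a set \<Rightarrow> 'a set set \<Rightarrow> ('a set \<Rightarrow> nat) \<Rightarrow> 'a set \<Rightarrow> bool" where
  "circuit U \<Omega> r C \<longleftrightarrow> dependent U \<Omega> r C \<and> (\<forall>S. dependent U \<Omega> r S \<and> S \<subseteq> C \<longrightarrow> S = C)"

definition has_fund_circuit ::
    "'a set \<Rightarrow> 'a set set \<Rightarrow> ('a set \<Rightarrow> nat) \<Rightarrow> 'a set \<Rightarrow> 'a set \<Rightarrow> bool" where
  "has_fund_circuit U \<Omega> r B \<omega> \<longleftrightarrow> (\<exists>C. circuit U \<Omega> r C \<and> C \<subseteq> B \<union> \<omega>)"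

definition fund_circuit ::
    "'a set \<Rightarrow> 'a set set \<Rightarrow> ('a set \<Rightarrow> nat) \<Rightarrow> 'a set \<Rightarrow> 'a set \<Rightarrow> 'a set" where
  "fund_circuit U \<Omega> r B \<omega> = (THE C. circuit U \<Omega> r C \<and> C \<subseteq> B \<union> \<omega>)"

text \<open>
  The strict order \<open>ord\<close> on skew classes is a set of pairs, with \<open>(\<omega>, \<eta>) \<in> ord\<close>
  meaning that \<open>\<omega>\<close> precedes \<open>\<eta>\<close>. It is lifted to elements of \<open>U\<close>; the lifted relation
  is total on each subtransversal, so \<open>min_elem\<close> is well defined on non-empty ones.
\<close>

definition elem_less :: "'a set set \<Rightarrow> 'a set rel \<Rightarrow> 'a \<Rightarrow> 'a \<Rightarrow> bool" where
  "elem_less \<Omega> ord x y \<longleftrightarrow> (\<exists>\<omega>\<in>\<Omega>. \<exists>\<eta>\<in>\<Omega>. x \<in> \<omega> \<and> y \<in> \<eta> \<and> (\<omega>, \<eta>) \<in> ord)"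

definition min_elem :: "'a set set \<Rightarrow> 'a set rel \<Rightarrow> 'a set \<Rightarrow> 'a" where
  "min_elem \<Omega> ord S = (THE x. x \<in> S \<and> (\<forall>y\<in>S. y \<noteq> x \<longrightarrow> elem_less \<Omega> ord x y))"

definition act ::
    "'a set \<Rightarrow> 'a set set \<Rightarrow> ('a set \<Rightarrow> nat) \<Rightarrow> 'a set rel \<Rightarrow> 'a set \<Rightarrow> 'a set set" where
  "act U \<Omega> r ord B =
     {\<omega>\<in>\<Omega>. has_fund_circuit U \<Omega> r B \<omega> \<and> min_elem \<Omega> ord (fund_circuit U \<Omega> r B \<omega>) \<in> \<omega>}"

text \<open>
  \<open>the_elem (S \<inter> \<omega>)\<close> is the element \<open>S\<^sub>\<omega>\<close>, and \<open>the_elem (fund_circuit U \<Omega> r B \<omega> - B)\<close>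
  is the element written as \<open>B\<^sub>\<omega>\<close> with an underlined \<open>B\<close>.
\<close>

definition B_int ::
    "'a set \<Rightarrow> 'a set set \<Rightarrow> ('a set \<Rightarrow> nat) \<Rightarrow> 'a set rel \<Rightarrow> 'a set \<Rightarrow> 'a set" where
  "B_int U \<Omega> r ord B = (\<lambda>\<omega>. the_elem (B \<inter> \<omega>)) ` act U \<Omega> r ord B"

definition B_ext ::
    "'a set \<Rightarrow> 'a set set \<Rightarrow> ('a set \<Rightarrow> nat) \<Rightarrow> 'a set rel \<Rightarrow> 'a set \<Rightarrow> 'a set" where
  "B_ext U \<Omega> r ord B = (\<lambda>\<omega>. the_elem (fund_circuit U \<Omega> r B \<omega> - B)) ` act U \<Omega> r ord B"

definition H_set ::
    "'a set \<Rightarrow> 'a set set \<Rightarrow> ('a set \<Rightarrow> nat) \<Rightarrow> 'a set rel \<Rightarrow> 'a set \<Rightarrow> 'a set set" where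
  "H_set U \<Omega> r ord B =
     {T. transversal U \<Omega> T \<and> B - B_int U \<Omega> r ord B \<subseteq> T \<and> T \<subseteq> B \<union> B_ext U \<Omega> r ord B}"

definition mce ::
    "'a set \<Rightarrow> 'a set set \<Rightarrow> ('a set \<Rightarrow> nat) \<Rightarrow> 'a set rel \<Rightarrow> 'a set \<Rightarrow> 'a set" where
  "mce U \<Omega> r ord S = {min_elem \<Omega> ord C | C. C \<subseteq> S \<and> circuit U \<Omega> r C}"

definition mcs ::
    "'a set \<Rightarrow> 'a set set \<Rightarrow> ('a set \<Rightarrow> nat) \<Rightarrow> 'a set rel \<Rightarrow> 'a set \<Rightarrow> 'a set set" where
  "mcs U \<Omega> r ord S = {\<omega>\<in>\<Omega>. \<omega> \<inter> mce U \<Omega> r ord S \<noteq> {}}"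

end

theory Submission
  imports Defs
begin

text \<open>
  Choose \<open>B\<close> class by class, from the greatest skew class down. Write \<open>Q\<close> for the part of \<open>B\<close>
  in the classes above \<open>\<omega>\<close>. By (R2) at most one element of \<open>\<omega>\<close> is spanned by \<open>Q\<close>, and \<open>B\<close> is a
  basis iff it always avoids that element. The class \<open>\<omega>\<close> is active iff such an element exists, which
  is then the external element; so \<open>T \<in> H(B)\<close> says that, for every \<open>\<omega>\<close>, either \<open>B\<close> and \<open>T\<close>
  agree in \<open>\<omega>\<close> or \<open>T\<^sub>\<omega>\<close> is spanned by \<open>Q\<close>. Hence there are \<open>card \<omega> - 1\<close> choices if
  \<open>T\<^sub>\<omega>\<close> is spanned by \<open>Q\<close>, and one otherwise. Throughout the process, contracting
  \<open>Q\<close> and contracting the part of \<open>T\<close> above \<open>\<omega>\<close> give the same rank function on the remaining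
  classes, so \<open>T\<^sub>\<omega>\<close> is spanned by \<open>Q\<close> iff it is spanned by that part of \<open>T\<close>, that is,
  iff \<open>\<omega> \<in> mcs(T)\<close>.
\<close>

locale ordered_multimatroid =
  fixes U :: "'a set" and \<Omega> :: "'a set set" and r :: "'a set \<Rightarrow> nat" and ord :: "'a set rel"
  assumes mm: "multimatroid U \<Omega> r"
    and nondeg: "non_degenerate \<Omega>"
    and lin: "strict_linear_order_on \<Omega> ord"
begin

text \<open>Membership of \<open>x\<close> in the matroid closure of \<open>S\<close>. It carries
  meaning only when \<open>insert x S\<close> is a subtransversal, and it holds trivially for
  \<open>x\<close> in \<open>S\<close>.\<close>

definition spans :: "'a set \<Rightarrow> 'a \<Rightarrow> bool" where
  "spans S x \<longleftrightarrow> r (insert x S) = r S"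

text \<open>A set of elements rather than of classes, so that \<open>S \<inter> up \<omega>\<close>
  is the part of \<open>S\<close> strictly above \<open>\<omega>\<close>.\<close>

definition up :: "'a set \<Rightarrow> 'a set" where
  "up \<omega> = \<Union>{\<eta>\<in>\<Omega>. (\<omega>, \<eta>) \<in> ord}"

abbreviation st :: "'a set \<Rightarrow> bool" where
  "st \<equiv> subtransversal U \<Omega>"

section \<open>Carriers, subtransversals and transversals\<close>

lemma finite_U: "finite U" and Union_classes: "\<Union>\<Omega> = U"
  and class_nonempty: "\<omega> \<in> \<Omega> \<Longrightarrow> \<omega> \<noteq> {}"
  and class_unique: "\<omega> \<in> \<Omega> \<Longrightarrow> \<eta> \<in> \<Omega> \<Longrightarrow> x \<in> \<omega> \<Longrightarrow> x \<in> \<eta> \<Longrightarrow> \<omega> = \<eta>"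
  using mm unfolding multimatroid_def is_carrier_def partition_on_def disjoint_def by auto

lemma finite_classes: "finite \<Omega>"
  using finite_U Union_classes finite_UnionD by metis

lemma finite_class: "\<omega> \<in> \<Omega> \<Longrightarrow> finite \<omega>"
  using finite_U Union_classes by (metis Union_upper finite_subset)

text \<open>Replaces the cardinality bounds by an elementwise condition. Finiteness of the classes
  enters because \<open>card\<close> of an infinite set is 0.\<close>

lemma st_iff:
  "st S \<longleftrightarrow> S \<subseteq> U \<and> (\<forall>\<omega>\<in>\<Omega>. \<forall>x\<in>S. \<forall>y\<in>S. x \<in> \<omega> \<and> y \<in> \<omega> \<longrightarrow> x = y)"
proof -
  have "card (S \<inter> \<omega>) \<le> 1 \<longleftrightarrow> (\<forall>x\<in>S. \<forall>y\<in>S. x \<in> \<omega> \<and> y \<in> \<omega> \<longrightarrow> x = y)"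
    if "\<omega> \<in> \<Omega>" for \<omega>
    using finite_class[OF that] by (auto simp: card_le_Suc0_iff_eq)
  then show ?thesis unfolding subtransversal_def by (intro conj_cong ball_cong refl)
qed

lemma st_subset: "st S \<Longrightarrow> S' \<subseteq> S \<Longrightarrow> st S'"
  unfolding st_iff by blast

lemma st_finite: "st S \<Longrightarrow> finite S"
  unfolding subtransversal_def using finite_U finite_subset by blast

lemma st_eq: "st S \<Longrightarrow> \<omega> \<in> \<Omega> \<Longrightarrow> x \<in> S \<Longrightarrow> x \<in> \<omega> \<Longrightarrow> y \<in> S \<Longrightarrow> y \<in> \<omega> \<Longrightarrow> x = y"
  unfolding st_iff by blast

lemma st_insert:
  assumes "st S" "\<omega> \<in> \<Omega>" "x \<in> \<omega>" "S \<inter> \<omega> = {}"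
  shows "st (insert x S)"
  using assms class_unique Union_classes unfolding st_iff by (smt (verit) IntI UnionI empty_iff insertE insert_subset)

lemma transversal_iff: "transversal U \<Omega> S \<longleftrightarrow> st S \<and> (\<forall>\<omega>\<in>\<Omega>. S \<inter> \<omega> \<noteq> {})"
proof -
  have "card (S \<inter> \<omega>) = 1 \<longleftrightarrow> card (S \<inter> \<omega>) \<le> 1 \<and> S \<inter> \<omega> \<noteq> {}" if "\<omega> \<in> \<Omega>" for \<omega>
    using finite_class[OF that] by (metis card_0_eq finite_Int le_antisym le_refl less_one linorder_not_less)
  then show ?thesis unfolding transversal_def subtransversal_def by auto
qed

lemma st_extend:
  assumes "st S"
  obtains T where "transversal U \<Omega> T" "S \<subseteq> T"
proof -
  \<comment> \<open>The chosen element comes from \<open>S\<close> whenever \<open>S\<close> meets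
    the class. Since \<open>S\<close> meets it at most once, the choice is then forced, so all of
    \<open>S\<close> lies in the image of \<open>f\<close>.\<close>
  define f where "f \<omega> = (SOME x. x \<in> \<omega> \<and> (S \<inter> \<omega> \<noteq> {} \<longrightarrow> x \<in> S))" for \<omega>
  have f: "f \<omega> \<in> \<omega> \<and> (S \<inter> \<omega> \<noteq> {} \<longrightarrow> f \<omega> \<in> S)" if "\<omega> \<in> \<Omega>" for \<omega>
  proof -
    have "\<exists>x. x \<in> \<omega> \<and> (S \<inter> \<omega> \<noteq> {} \<longrightarrow> x \<in> S)" using class_nonempty[OF that] by blast
    then show ?thesis unfolding f_def by (rule someI_ex)
  qed
  have "f ` \<Omega> \<subseteq> U" using f Union_classes by blast
  moreover have "x = y"
    if *: "\<omega> \<in> \<Omega>" "x \<in> f ` \<Omega>" "x \<in> \<omega>" "y \<in> f ` \<Omega>" "y \<in> \<omega>" for \<omega> x y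
  proof -
    obtain \<alpha> \<beta> where "\<alpha> \<in> \<Omega>" "x = f \<alpha>" "\<beta> \<in> \<Omega>" "y = f \<beta>" using * by blast
    then show ?thesis using *(1,3,5) f class_unique by metis
  qed
  ultimately have "st (f ` \<Omega>)" unfolding st_iff by blast
  then have "transversal U \<Omega> (f ` \<Omega>)" unfolding transversal_iff using f by blast
  moreover have "S \<subseteq> f ` \<Omega>"
  proof
    fix x assume x: "x \<in> S"
    then obtain \<omega> where w: "\<omega> \<in> \<Omega>" "x \<in> \<omega>"
      using assms Union_classes unfolding st_iff by blast
    then have "f \<omega> = x" using f[OF w(1)] x st_eq[OF assms] by blast
    then show "x \<in> f ` \<Omega>" using w by blast
  qed
  ultimately show thesis using that by blast
qed

section \<open>The rank function on subtransversals\<close>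

lemma matroid_rank_on_st:
  assumes "st S"
  shows "matroid_rank_on S r"
proof -
  \<comment> \<open>(R1) speaks of transversals only. The rank axioms pass from a transversal
    containing \<open>S\<close> down to \<open>S\<close>.\<close>
  obtain T where T: "transversal U \<Omega> T" "S \<subseteq> T" using st_extend[OF assms] .
  then have "matroid_rank_on T r" using mm unfolding multimatroid_def by blast
  then show ?thesis using T(2) finite_subset unfolding matroid_rank_on_def
    by (meson subset_trans)
qed

lemma rank_le_card: "st S \<Longrightarrow> r S \<le> card S"
  using matroid_rank_on_st unfolding matroid_rank_on_def by blast

lemma rank_mono: "st S \<Longrightarrow> S' \<subseteq> S \<Longrightarrow> r S' \<le> r S"
  using matroid_rank_on_st unfolding matroid_rank_on_def by blast

lemma rank_submodular: "st (X \<union> Y) \<Longrightarrow> r (X \<union> Y) + r (X \<inter> Y) \<le> r X + r Y"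
  using matroid_rank_on_st[of "X \<union> Y"] unfolding matroid_rank_on_def by blast

lemma rank_insert_le:
  assumes "st (insert x S)"
  shows "r (insert x S) \<le> r S + 1"
proof -
  have "r {x} \<le> 1" using rank_le_card[of "{x}"] st_subset[OF assms] by auto
  then show ?thesis using rank_submodular[of S "{x}"] assms by simp
qed

lemma spans_iff: "st (insert x S) \<Longrightarrow> \<not> spans S x \<longleftrightarrow> r (insert x S) = r S + 1"
  unfolding spans_def using rank_insert_le[of x S] rank_mono[OF _ subset_insertI, of x S] by linarith

text \<open>Submodularity for \<open>insert x S\<close> and \<open>S'\<close>: if \<open>x\<close>
  is outside \<open>S'\<close>, they meet in \<open>S\<close>, so the gain from adding
  \<open>x\<close> to \<open>S'\<close> is at most the gain from adding it to
  \<open>S\<close>.\<close>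

lemma spans_mono:
  assumes "spans S x" "S \<subseteq> S'" "st (insert x S')"
  shows "spans S' x"
proof (cases "x \<in> S'")
  case False
  have "r (insert x S' ) + r (insert x S \<inter> S') \<le> r (insert x S) + r S'"
    using rank_submodular[of "insert x S" S'] assms(2,3) by (simp add: Un_absorb1)
  moreover have "insert x S \<inter> S' = S" using False assms(2) by blast
  ultimately show ?thesis
    using assms(1) rank_mono[OF assms(3) subset_insertI] unfolding spans_def by simp
qed (simp add: spans_def insert_absorb)

text \<open>The form in which (R2) enters: two distinct spanned elements of one class would make the
  left side of (R2) equal to 0.\<close>

lemma spans_unique:
  assumes "st S" "\<omega> \<in> \<Omega>" "S \<inter> \<omega> = {}" "x \<in> \<omega>" "y \<in> \<omega>" "spans S x" "spans S y"
  shows "x = y"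
proof (rule ccontr)
  assume "x \<noteq> y"
  then have "int (r (S \<union> {x})) + int (r (S \<union> {y})) - 2 * int (r S) \<ge> 1"
    using mm assms(1-5) unfolding multimatroid_def by blast
  then show False using assms(6,7) unfolding spans_def by simp
qed

section \<open>Independent sets and circuits\<close>

lemma indep_iff: "indep U \<Omega> r S \<longleftrightarrow> st S \<and> r S = card S"
  unfolding indep_def nullity_def by auto

lemma dependent_iff: "dependent U \<Omega> r S \<longleftrightarrow> st S \<and> r S < card S"
  unfolding dependent_def nullity_def using rank_le_card[of S] by auto

lemma indep_subset:
  assumes "indep U \<Omega> r S" "D \<subseteq> S"
  shows "indep U \<Omega> r D"
proof -
  have S: "st S" "r S = card S" using assms(1) unfolding indep_iff by auto
  have st: "st D" "st (S - D)" using st_subset[OF S(1)] assms(2) by auto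
  \<comment> \<open>Both parts have rank at most their size, and their ranks add up to at least
    \<open>card S\<close>; hence equality holds in both.\<close>
  have "r S \<le> r D + r (S - D)"
    using rank_submodular[of D "S - D"] assms(2) S(1) by (simp add: Un_absorb1)
  moreover have "card S = card D + card (S - D)"
    using st_finite[OF S(1)] assms(2) by (metis card_Diff_subset card_mono finite_subset le_add_diff_inverse)
  ultimately have "r D = card D"
    using rank_le_card[OF st(1)] rank_le_card[OF st(2)] S(2) by linarith
  then show ?thesis using st(1) unfolding indep_iff by blast
qed

lemma indep_insert_not_spans:
  assumes "indep U \<Omega> r (insert x S)" "x \<notin> S"
  shows "\<not> spans S x"
proof -
  have "indep U \<Omega> r S" using indep_subset[OF assms(1)] by blast
  then show ?thesis using assms st_finite[of S] unfolding indep_iff spans_def by auto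
qed

lemma circuit_st: "circuit U \<Omega> r C \<Longrightarrow> st C"
  unfolding circuit_def dependent_iff by blast

lemma circuit_not_indep: "circuit U \<Omega> r C \<Longrightarrow> indep U \<Omega> r S \<Longrightarrow> \<not> C \<subseteq> S"
  using indep_subset[of S C] unfolding circuit_def dependent_iff indep_iff by auto

lemma circuit_proper_subset:
  assumes "circuit U \<Omega> r C" "D \<subset> C"
  shows "r D = card D"
proof -
  have "st D" using circuit_st[OF assms(1)] assms(2) st_subset by blast
  moreover have "\<not> dependent U \<Omega> r D" using assms unfolding circuit_def by blast
  ultimately show ?thesis using rank_le_card[of D] unfolding dependent_iff by linarith
qed

lemma circuit_spans:
  assumes "circuit U \<Omega> r C" "x \<in> C"
  shows "spans (C - {x}) x"
proof -
  have C: "st C" "r C < card C" using assms(1) unfolding circuit_def dependent_iff by auto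
  have "r (C - {x}) = card (C - {x})" using circuit_proper_subset assms by blast
  then show ?thesis
    using C assms(2) rank_mono[OF C(1), of "C - {x}"] st_finite[OF C(1)]
    by (simp add: spans_def insert_absorb)
qed

lemma circuit_rank:
  assumes "circuit U \<Omega> r C"
  shows "r C + 1 \<le> card C"
  using assms unfolding circuit_def dependent_iff by auto

lemma dependent_contains_circuit:
  assumes "dependent U \<Omega> r S"
  obtains C where "circuit U \<Omega> r C" "C \<subseteq> S"
proof -
  have "finite {D. dependent U \<Omega> r D \<and> D \<subseteq> S}"
    using assms st_finite[of S] unfolding dependent_iff by (auto intro: finite_subset[of _ "Pow S"])
  then obtain C where C: "C \<subseteq> S" "dependent U \<Omega> r C" "\<forall>D. dependent U \<Omega> r D \<and> D \<subseteq> S \<longrightarrow> D \<subseteq> C \<longrightarrow> C = D"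
    using finite_has_minimal2[of "{D. dependent U \<Omega> r D \<and> D \<subseteq> S}" S] assms by auto
  then have "circuit U \<Omega> r C" unfolding circuit_def by (metis subset_trans)
  then show thesis using that C(1) by blast
qed

text \<open>Greedy construction: run through \<open>S\<close> and keep an element only if it is not
  spanned by what came before.\<close>

lemma spanning_indep_subset:
  assumes "st S"
  shows "\<exists>D\<subseteq>S. indep U \<Omega> r D \<and> r D = r S"
  using st_finite[OF assms] assms
proof (induction S rule: finite_induct)
  case empty
  then show ?case using rank_le_card[of "{}"] unfolding indep_iff by auto
next
  case (insert x S)
  then obtain D where D: "D \<subseteq> S" "indep U \<Omega> r D" "r D = r S"
    using st_subset[of "insert x S" S] by blast
  show ?case
  proof (cases "spans S x")
    case True
    then show ?thesis using D unfolding spans_def by (metis subset_insertI2)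
  next
    case False
    have st: "st (insert x D)" using st_subset[OF insert.prems] D(1) by blast
    have "\<not> spans D x" using False spans_mono[OF _ D(1) insert.prems] by blast
    then have r: "r (insert x D) = r D + 1" using spans_iff[OF st] by blast
    then have "r (insert x D) = r (insert x S)" using D(3) False spans_iff[OF insert.prems] by simp
    moreover have "x \<notin> D" "finite D"
      using insert.hyps D(1) finite_subset by blast+
    ultimately show ?thesis using D(1,2) r st unfolding indep_iff
      by (intro exI[of _ "insert x D"]) auto
  qed
qed

text \<open>A circuit found in \<open>insert x S\<close> directly might avoid \<open>x\<close>.
  Replacing \<open>S\<close> by an independent subset \<open>D\<close> of the same rank keeps
  \<open>insert x D\<close> dependent and forces each of its circuits through
  \<open>x\<close>.\<close>

lemma spans_imp_circuit:
  assumes "spans S x" "x \<notin> S" "st (insert x S)"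
  obtains C where "circuit U \<Omega> r C" "x \<in> C" "C \<subseteq> insert x S"
proof -
  obtain D where D: "D \<subseteq> S" "indep U \<Omega> r D" "r D = r S"
    using spanning_indep_subset st_subset[OF assms(3)] by blast
  have st: "st (insert x D)" using st_subset[OF assms(3)] D(1) by blast
  have "r (insert x D) \<le> r (insert x S)" using rank_mono[OF assms(3)] D(1) by blast
  also have "\<dots> = card D" using assms(1) D(2,3) unfolding spans_def indep_iff by simp
  also have "\<dots> < card (insert x D)"
    using st_finite[OF st] assms(2) D(1) by (auto simp: card_insert_if)
  finally have "dependent U \<Omega> r (insert x D)" using st unfolding dependent_iff by blast
  then obtain C where C: "circuit U \<Omega> r C" "C \<subseteq> insert x D"
    by (rule dependent_contains_circuit)
  then have "x \<in> C" using circuit_not_indep[OF C(1) D(2)] by blast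
  then show thesis using that C D(1) by blast
qed

text \<open>If the circuits differ, their intersection is independent, and submodularity bounds the
  rank of \<open>C \<union> D\<close> by its size minus 2. But deleting \<open>x\<close> leaves a
  subset of the independent set \<open>S\<close>, so the rank is at least the size minus 1.\<close>

lemma indep_insert_circuit_unique:
  assumes "indep U \<Omega> r S" "st (insert x S)"
    and C: "circuit U \<Omega> r C" "C \<subseteq> insert x S" and D: "circuit U \<Omega> r D" "D \<subseteq> insert x S"
  shows "C = D"
proof (rule ccontr)
  assume ne: "C \<noteq> D"
  have x: "x \<in> C" using C(2) circuit_not_indep[OF C(1) assms(1)] by blast
  have st: "st (C \<union> D)" using st_subset[OF assms(2)] C(2) D(2) by blast
  note fin = st_finite[OF circuit_st[OF C(1)]] st_finite[OF circuit_st[OF D(1)]]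
  have "\<not> C \<subseteq> D" using ne C(1) D(1) unfolding circuit_def by metis
  then have "C \<inter> D \<subset> C" by blast
  then have "r (C \<inter> D) = card (C \<inter> D)" using circuit_proper_subset[OF C(1)] by blast
  moreover have "card C + card D = card (C \<union> D) + card (C \<inter> D)"
    using card_Un_Int fin by blast
  moreover have "C \<union> D - {x} \<subseteq> S" using C(2) D(2) by blast
  then have "r (C \<union> D - {x}) = card (C \<union> D - {x})" using indep_subset[OF assms(1)] indep_iff by metis
  then have "card (C \<union> D) - 1 \<le> r (C \<union> D)"
    using rank_mono[OF st Diff_subset, of "{x}"] x by simp
  ultimately show False
    using rank_submodular[OF st] circuit_rank[OF C(1)] circuit_rank[OF D(1)] by linarith
qed

subsection \<open>Bases and fundamental circuits\<close>

text \<open>This is where non-degeneracy enters. A class missed by \<open>B\<close> has two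
  elements, \<open>B\<close> spans at most one of them, and the other could be added to
  \<open>B\<close>.\<close>

lemma basis_transversal:
  assumes "basis U \<Omega> r B"
  shows "transversal U \<Omega> B"
proof -
  have ind: "indep U \<Omega> r B" and max: "\<And>S. indep U \<Omega> r S \<Longrightarrow> B \<subseteq> S \<Longrightarrow> S = B"
    using assms unfolding basis_def by blast+
  have B: "st B" "r B = card B" using ind unfolding indep_iff by auto
  have "B \<inter> \<omega> \<noteq> {}" if w: "\<omega> \<in> \<Omega>" for \<omega>
  proof
    assume e: "B \<inter> \<omega> = {}"
    have "\<not> card \<omega> \<le> Suc 0" using nondeg w unfolding non_degenerate_def by force
    then obtain x y where xy: "x \<in> \<omega>" "y \<in> \<omega>" "x \<noteq> y"
      using finite_class[OF w] card_le_Suc0_iff_eq by metis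
    then obtain z where z: "z \<in> \<omega>" "\<not> spans B z" using spans_unique[OF B(1) w e] by blast
    have st: "st (insert z B)" using st_insert[OF B(1) w z(1) e] .
    have "z \<notin> B" using z e by blast
    moreover have "indep U \<Omega> r (insert z B)"
      using st spans_iff[OF st] z(2) B st_finite[OF B(1)] \<open>z \<notin> B\<close> unfolding indep_iff by simp
    ultimately show False using max[of "insert z B"] by blast
  qed
  then show ?thesis using B(1) unfolding transversal_iff by blast
qed

lemma indep_transversal_basis:
  assumes "transversal U \<Omega> B" "indep U \<Omega> r B"
  shows "basis U \<Omega> r B"
proof -
  have "S = B" if "indep U \<Omega> r S" "B \<subseteq> S" for S
  proof
    show "S \<subseteq> B"
    proof
      fix x assume x: "x \<in> S"
      have S: "st S" using that unfolding indep_iff by blast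
      obtain \<omega> where "\<omega> \<in> \<Omega>" "x \<in> \<omega>" using S x Union_classes unfolding st_iff by blast
      moreover then obtain y where "y \<in> B" "y \<in> \<omega>" using assms(1) unfolding transversal_iff by blast
      ultimately show "x \<in> B" using st_eq[OF S] x that(2) by blast
    qed
  qed (fact that)
  then show ?thesis using assms(2) unfolding basis_def by blast
qed

text \<open>\<open>B \<union> \<omega>\<close> is in general no subtransversal, so uniqueness inside
  a matroid does not apply at once. Each circuit in it passes through an element of
  \<open>\<omega>\<close> spanned by \<open>B - \<omega>\<close>. By \<open>spans_unique\<close>
  this is the same element for both circuits, which places them in one subtransversal.\<close>

lemma fund_circuit_unique:
  assumes "indep U \<Omega> r B" "\<omega> \<in> \<Omega>"
    and C: "circuit U \<Omega> r C" "C \<subseteq> B \<union> \<omega>" and D: "circuit U \<Omega> r D" "D \<subseteq> B \<union> \<omega>"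
  shows "C = D"
proof -
  have ind: "indep U \<Omega> r (B - \<omega>)" using indep_subset[OF assms(1)] by blast
  then have st: "st (B - \<omega>)" unfolding indep_iff by blast
  have *: "\<exists>x\<in>\<omega>. x \<in> E \<and> E \<subseteq> insert x (B - \<omega>) \<and> spans (B - \<omega>) x"
    if E: "circuit U \<Omega> r E" "E \<subseteq> B \<union> \<omega>" for E
  proof -
    obtain x where x: "x \<in> E" "x \<in> \<omega>"
      \<comment> \<open>\<open>E\<close> cannot lie inside the independent set \<open>B\<close>, so
        it has an element outside \<open>B\<close>, and this belongs to
        \<open>\<omega>\<close>.\<close>
      using circuit_not_indep[OF E(1) assms(1)] E(2) by blast
    have sub: "E \<subseteq> insert x (B - \<omega>)"
      using st_eq[OF circuit_st[OF E(1)] assms(2)] x E(2) by blast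
    have "st (insert x (B - \<omega>))" using st_insert[OF st assms(2) x(2)] by blast
    then have "spans (B - \<omega>) x"
      using spans_mono[OF circuit_spans[OF E(1) x(1)], of "B - \<omega>"] sub by blast
    then show ?thesis using x sub by blast
  qed
  obtain x where x: "x \<in> \<omega>" "C \<subseteq> insert x (B - \<omega>)" "spans (B - \<omega>) x" using *[OF C] by blast
  moreover obtain y where y: "y \<in> \<omega>" "D \<subseteq> insert y (B - \<omega>)" "spans (B - \<omega>) y" using *[OF D] by blast
  moreover have "x = y" using spans_unique[OF st assms(2)] x y by blast
  ultimately show ?thesis
    using indep_insert_circuit_unique[OF ind _ C(1) _ D(1)] st_insert[OF st assms(2) x(1)] by blast
qed

lemma fund_circuit_eq:
  assumes "indep U \<Omega> r B" "\<omega> \<in> \<Omega>" "circuit U \<Omega> r C" "C \<subseteq> B \<union> \<omega>"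
  shows "fund_circuit U \<Omega> r B \<omega> = C"
  unfolding fund_circuit_def using fund_circuit_unique[OF assms(1,2)] assms(3,4)
  by (intro the_equality) blast+

subsection \<open>The order and activity\<close>

lemma ord_trans: "(a, b) \<in> ord \<Longrightarrow> (b, c) \<in> ord \<Longrightarrow> (a, c) \<in> ord"
  and ord_irrefl: "(a, a) \<notin> ord"
  and ord_total: "a \<in> \<Omega> \<Longrightarrow> b \<in> \<Omega> \<Longrightarrow> a \<noteq> b \<Longrightarrow> (a, b) \<in> ord \<or> (b, a) \<in> ord"
  using lin unfolding strict_linear_order_on_def trans_def irrefl_def total_on_def by blast+

lemma least_class:
  assumes "finite A" "A \<noteq> {}" "A \<subseteq> \<Omega>"
  shows "\<exists>\<omega>\<in>A. \<forall>\<eta>\<in>A. \<eta> \<noteq> \<omega> \<longrightarrow> (\<omega>, \<eta>) \<in> ord"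
  using assms
proof (induction A rule: finite_ne_induct)
  case (insert \<alpha> A)
  obtain \<omega> where w: "\<omega> \<in> A" "\<forall>\<eta>\<in>A. \<eta> \<noteq> \<omega> \<longrightarrow> (\<omega>, \<eta>) \<in> ord"
    using insert.IH insert.prems by auto
  then have "\<omega> \<in> \<Omega>" "\<alpha> \<in> \<Omega>" "\<omega> \<noteq> \<alpha>" using insert.hyps(3) insert.prems by blast+
  then have "(\<omega>, \<alpha>) \<in> ord \<or> (\<alpha>, \<omega>) \<in> ord" using ord_total by blast
  then show ?case
  proof
    assume a: "(\<alpha>, \<omega>) \<in> ord"
    have "(\<alpha>, \<eta>) \<in> ord" if "\<eta> \<in> A" for \<eta>
      using a w(2) that ord_trans[OF a, of \<eta>] by metis
    then show ?thesis by blast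
  qed (use w in blast)
qed simp

lemma up_disjoint: "\<omega> \<in> \<Omega> \<Longrightarrow> up \<omega> \<inter> \<omega> = {}"
  unfolding up_def using ord_irrefl class_unique by blast

lemma elem_less_iff: "\<omega> \<in> \<Omega> \<Longrightarrow> x \<in> \<omega> \<Longrightarrow> elem_less \<Omega> ord x y \<longleftrightarrow> y \<in> up \<omega>"
  unfolding elem_less_def up_def using class_unique by blast

text \<open>The inclusion in \<open>insert x (up \<omega>)\<close> serves as a certificate for the
  minimum; later arguments use it in place of the definite description.\<close>

lemma min_elem_eq:
  assumes "\<omega> \<in> \<Omega>" "x \<in> \<omega>" "x \<in> C" "C \<subseteq> insert x (up \<omega>)"
  shows "min_elem \<Omega> ord C = x"
  unfolding min_elem_def
proof (rule the_equality)
  show "x \<in> C \<and> (\<forall>y\<in>C. y \<noteq> x \<longrightarrow> elem_less \<Omega> ord x y)"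
    using assms elem_less_iff by blast
  fix z assume z: "z \<in> C \<and> (\<forall>y\<in>C. y \<noteq> z \<longrightarrow> elem_less \<Omega> ord z y)"
  show "z = x"
  \<comment> \<open>A rival \<open>z\<close> lies in a class above \<open>\<omega>\<close> and yet
    precedes \<open>x\<close>; this closes a cycle in the order.\<close>
  proof (rule ccontr)
    assume "z \<noteq> x"
    then obtain \<eta> where n: "\<eta> \<in> \<Omega>" "(\<omega>, \<eta>) \<in> ord" "z \<in> \<eta>" using z assms(4) unfolding up_def by blast
    have "elem_less \<Omega> ord z x" using z assms(3) \<open>z \<noteq> x\<close> by metis
    then obtain \<zeta> where "\<zeta> \<in> \<Omega>" "(\<eta>, \<zeta>) \<in> ord" "x \<in> \<zeta>" unfolding elem_less_iff[OF n(1,3)] up_def by blast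
    moreover have "\<zeta> = \<omega>" using class_unique[OF _ assms(1) _ assms(2)] calculation by blast
    ultimately show False using ord_trans[OF n(2), of \<omega>] ord_irrefl by blast
  qed
qed

text \<open>The minimum lies in the least class that meets \<open>C\<close>; every other element of
  \<open>C\<close> is then in a greater class.\<close>

lemma min_elem_cases:
  assumes "st C" "C \<noteq> {}"
  obtains \<omega> x where "\<omega> \<in> \<Omega>" "x \<in> \<omega>" "x \<in> C" "C \<subseteq> insert x (up \<omega>)" "min_elem \<Omega> ord C = x"
proof -
  define A where "A = {\<eta>\<in>\<Omega>. C \<inter> \<eta> \<noteq> {}}"
  have CU: "C \<subseteq> \<Union>\<Omega>" using assms(1) Union_classes unfolding st_iff by blast
  then have "A \<noteq> {}" using assms(2) unfolding A_def by blast
  then obtain \<omega> where w: "\<omega> \<in> A" "\<forall>\<eta>\<in>A. \<eta> \<noteq> \<omega> \<longrightarrow> (\<omega>, \<eta>) \<in> ord"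
    using least_class[of A] finite_classes unfolding A_def by auto
  then obtain x where x: "x \<in> C" "x \<in> \<omega>" unfolding A_def by blast
  have wO: "\<omega> \<in> \<Omega>" using w unfolding A_def by blast
  have "C \<subseteq> insert x (up \<omega>)"
  proof
    fix y assume y: "y \<in> C"
    then obtain \<eta> where n: "\<eta> \<in> \<Omega>" "y \<in> \<eta>" using CU by blast
    then have "\<eta> \<in> A" using y unfolding A_def by blast
    then show "y \<in> insert x (up \<omega>)"
      using w(2) n y x st_eq[OF assms(1) wO] unfolding up_def by (cases "\<eta> = \<omega>") blast+
  qed
  then show thesis using that wO x min_elem_eq by blast
qed

text \<open>The bridge from circuits with minimum \<open>x\<close> to spanning. It is used for
  \<open>x\<close> in \<open>S\<close> (to describe \<open>mcs\<close>) and for \<open>x\<close>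
  outside \<open>S\<close> (to describe activity). In the latter case \<open>insert x S\<close> may
  fail to be a subtransversal, but \<open>insert x (S \<inter> up \<omega>)\<close> always is
  one.\<close>

lemma circuit_min_elem_iff_spans:
  assumes "st S" "\<omega> \<in> \<Omega>" "x \<in> \<omega>" "x \<notin> S \<inter> up \<omega>"
  shows "(\<exists>C. circuit U \<Omega> r C \<and> C \<subseteq> insert x S \<and> x \<in> C \<and> C \<subseteq> insert x (up \<omega>)) \<longleftrightarrow> spans (S \<inter> up \<omega>) x"
proof
  have "st (S \<inter> up \<omega>)" using st_subset[OF assms(1)] by blast
  then have st: "st (insert x (S \<inter> up \<omega>))"
    using st_insert[OF _ assms(2,3)] up_disjoint[OF assms(2)] by blast
  show "spans (S \<inter> up \<omega>) x" if "\<exists>C. circuit U \<Omega> r C \<and> C \<subseteq> insert x S \<and> x \<in> C \<and> C \<subseteq> insert x (up \<omega>)"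
  proof -
    from that obtain C where C: "circuit U \<Omega> r C" "C \<subseteq> insert x S" "x \<in> C" "C \<subseteq> insert x (up \<omega>)"
      by blast
    then have "C - {x} \<subseteq> S \<inter> up \<omega>" by blast
    then show ?thesis using spans_mono[OF circuit_spans[OF C(1,3)] _ st] by blast
  qed
  show "\<exists>C. circuit U \<Omega> r C \<and> C \<subseteq> insert x S \<and> x \<in> C \<and> C \<subseteq> insert x (up \<omega>)" if spans: "spans (S \<inter> up \<omega>) x"
  proof -
    obtain C where "circuit U \<Omega> r C" "x \<in> C" "C \<subseteq> insert x (S \<inter> up \<omega>)"
      using spans_imp_circuit[OF spans assms(4) st] .
    then show ?thesis by blast
  qed
qed

section \<open>Class-by-class criteria for \<open>mcs\<close>, bases and
  \<open>H_set\<close>\<close>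

lemma circuit_nonempty: "circuit U \<Omega> r C \<Longrightarrow> C \<noteq> {}"
  using circuit_rank[of "{}"] by auto

lemma transversal_inter:
  assumes "transversal U \<Omega> T" "\<omega> \<in> \<Omega>"
  shows "T \<inter> \<omega> = {the_elem (T \<inter> \<omega>)}"
proof -
  have "card (T \<inter> \<omega>) = 1" using assms unfolding transversal_def by blast
  then obtain x where "T \<inter> \<omega> = {x}" by (rule card_1_singletonE)
  then show ?thesis by simp
qed

lemma transversal_the_elem:
  assumes "transversal U \<Omega> T" "\<omega> \<in> \<Omega>"
  shows "the_elem (T \<inter> \<omega>) \<in> T" "the_elem (T \<inter> \<omega>) \<in> \<omega>"
  using transversal_inter[OF assms] by blast+

lemma transversal_the_elem_eq:
  assumes "transversal U \<Omega> T" "\<omega> \<in> \<Omega>" "x \<in> T" "x \<in> \<omega>"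
  shows "the_elem (T \<inter> \<omega>) = x"
  using transversal_inter[OF assms(1,2)] assms(3,4) by (metis IntI singletonD)

lemma mcs_iff:
  assumes "transversal U \<Omega> T" "\<omega> \<in> \<Omega>"
  shows "\<omega> \<in> mcs U \<Omega> r ord T \<longleftrightarrow> spans (T \<inter> up \<omega>) (the_elem (T \<inter> \<omega>))"
proof -
  define t where "t = the_elem (T \<inter> \<omega>)"
  have t: "t \<in> T" "t \<in> \<omega>" unfolding t_def using transversal_the_elem[OF assms] by auto
  have T: "st T" using assms(1) unfolding transversal_iff by blast
  have "t \<notin> T \<inter> up \<omega>" using t up_disjoint[OF assms(2)] by blast
  note * = circuit_min_elem_iff_spans[OF T assms(2) t(2) this]
  have "\<omega> \<in> mcs U \<Omega> r ord T \<longleftrightarrow> (\<exists>C. circuit U \<Omega> r C \<and> C \<subseteq> T \<and> min_elem \<Omega> ord C \<in> \<omega>)"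
    unfolding mcs_def mce_def using assms(2) by blast
  \<comment> \<open>A minimum in \<open>\<omega>\<close> of a circuit inside \<open>T\<close> can
    only be \<open>t\<close>. As \<open>t\<close> is in \<open>T\<close>, inserting it changes
    nothing and merely matches the form of the bridge lemma.\<close>
  also have "\<dots> \<longleftrightarrow> (\<exists>C. circuit U \<Omega> r C \<and> C \<subseteq> insert t T \<and> t \<in> C \<and> C \<subseteq> insert t (up \<omega>))"
  proof (intro ex_cong1 conj_cong refl)
    fix C assume C: "circuit U \<Omega> r C"
    show "(C \<subseteq> T) = (C \<subseteq> insert t T)" using t by blast
    assume CT: "C \<subseteq> insert t T"
    obtain \<eta> x where x: "\<eta> \<in> \<Omega>" "x \<in> \<eta>" "x \<in> C" "C \<subseteq> insert x (up \<eta>)" "min_elem \<Omega> ord C = x"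
      using min_elem_cases[OF circuit_st[OF C] circuit_nonempty[OF C]] .
    show "(min_elem \<Omega> ord C \<in> \<omega>) = (t \<in> C \<and> C \<subseteq> insert t (up \<omega>))"
    proof
      assume "min_elem \<Omega> ord C \<in> \<omega>"
      then have "\<eta> = \<omega>" using x assms(2) class_unique by blast
      moreover have "x = t" using st_eq[OF T assms(2)] t x CT calculation by blast
      ultimately show "t \<in> C \<and> C \<subseteq> insert t (up \<omega>)" using x by blast
    next
      assume "t \<in> C \<and> C \<subseteq> insert t (up \<omega>)"
      then show "min_elem \<Omega> ord C \<in> \<omega>" using min_elem_eq[OF assms(2) t(2)] t by simp
    qed
  qed
  also have "\<dots> \<longleftrightarrow> spans (T \<inter> up \<omega>) t" by (fact *)
  finally show ?thesis unfolding t_def .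
qed

text \<open>A dependent transversal contains a circuit, and the class of its minimum belongs to
  \<open>mcs\<close> of \<open>B\<close>; by \<open>mcs_iff\<close>, the element of \<open>B\<close>
  in that class is spanned by the part of \<open>B\<close> above. Each condition sees only
  \<open>\<omega>\<close> and higher classes, which permits a choice from the top down.\<close>

lemma basis_iff:
  assumes "transversal U \<Omega> B"
  shows "basis U \<Omega> r B \<longleftrightarrow> (\<forall>\<omega>\<in>\<Omega>. \<not> spans (B \<inter> up \<omega>) (the_elem (B \<inter> \<omega>)))"
proof
  assume "basis U \<Omega> r B"
  then have ind: "indep U \<Omega> r B" unfolding basis_def by blast
  show "\<forall>\<omega>\<in>\<Omega>. \<not> spans (B \<inter> up \<omega>) (the_elem (B \<inter> \<omega>))"
  proof
    fix \<omega> assume w: "\<omega> \<in> \<Omega>"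
    note b = transversal_the_elem[OF assms w]
    show "\<not> spans (B \<inter> up \<omega>) (the_elem (B \<inter> \<omega>))"
      using b up_disjoint[OF w] by (intro indep_insert_not_spans indep_subset[OF ind]) auto
  qed
next
  assume *: "\<forall>\<omega>\<in>\<Omega>. \<not> spans (B \<inter> up \<omega>) (the_elem (B \<inter> \<omega>))"
  have B: "st B" using assms unfolding transversal_iff by blast
  have "indep U \<Omega> r B"
  proof (rule ccontr)
    assume "\<not> indep U \<Omega> r B"
    then have "dependent U \<Omega> r B" using B unfolding indep_def dependent_def by blast
    then obtain C where C: "circuit U \<Omega> r C" "C \<subseteq> B" by (rule dependent_contains_circuit)
    obtain \<omega> x where x: "\<omega> \<in> \<Omega>" "x \<in> \<omega>" "x \<in> C" "min_elem \<Omega> ord C = x"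
      using min_elem_cases[OF circuit_st[OF C(1)] circuit_nonempty[OF C(1)]] .
    then have "\<omega> \<in> mcs U \<Omega> r ord B" unfolding mcs_def mce_def using C by blast
    then show False using * mcs_iff[OF assms] x(1) by blast
  qed
  then show "basis U \<Omega> r B" by (rule indep_transversal_basis[OF assms])
qed

text \<open>Together with \<open>spans_imp_act\<close> this identifies the external element of an
  active class as the element of \<open>\<omega>\<close> spanned by
  \<open>B \<inter> up \<omega>\<close>.\<close>

lemma act_imp_spans:
  assumes "basis U \<Omega> r B" "\<omega> \<in> act U \<Omega> r ord B"
  shows "the_elem (fund_circuit U \<Omega> r B \<omega> - B) \<in> \<omega>"
    "spans (B \<inter> up \<omega>) (the_elem (fund_circuit U \<Omega> r B \<omega> - B))"
proof -
  have w: "\<omega> \<in> \<Omega>" and "has_fund_circuit U \<Omega> r B \<omega>"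
    and min: "min_elem \<Omega> ord (fund_circuit U \<Omega> r B \<omega>) \<in> \<omega>"
    using assms(2) unfolding act_def by auto
  then obtain C where C: "circuit U \<Omega> r C" "C \<subseteq> B \<union> \<omega>" unfolding has_fund_circuit_def by blast
  have ind: "indep U \<Omega> r B" and B: "st B" using assms(1) unfolding basis_def indep_iff by auto
  have fund: "fund_circuit U \<Omega> r B \<omega> = C" using fund_circuit_eq[OF ind w C] .
  obtain \<eta> x where x: "\<eta> \<in> \<Omega>" "x \<in> \<eta>" "x \<in> C" "C \<subseteq> insert x (up \<eta>)" "min_elem \<Omega> ord C = x"
    using min_elem_cases[OF circuit_st[OF C(1)] circuit_nonempty[OF C(1)]] .
  have [simp]: "\<eta> = \<omega>" using class_unique[OF x(1) w x(2)] min fund x(5) by simp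
  have sub: "C \<subseteq> insert x B" using C(2) x up_disjoint[OF w] by auto
  \<comment> \<open>Otherwise the circuit would lie inside the basis.\<close>
  have "x \<notin> B" using sub circuit_not_indep[OF C(1) ind] by (metis insert_absorb)
  then have "C - B = {x}" using sub x(3) by blast
  moreover have "spans (B \<inter> up \<omega>) x"
    using circuit_min_elem_iff_spans[OF B w, of x] \<open>x \<notin> B\<close> x C sub by auto
  ultimately show "the_elem (fund_circuit U \<Omega> r B \<omega> - B) \<in> \<omega>"
    "spans (B \<inter> up \<omega>) (the_elem (fund_circuit U \<Omega> r B \<omega> - B))"
    using fund x(2) by simp_all
qed

lemma spans_imp_act:
  assumes "basis U \<Omega> r B" "\<omega> \<in> \<Omega>" "x \<in> \<omega>" "spans (B \<inter> up \<omega>) x"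
  shows "\<omega> \<in> act U \<Omega> r ord B" "the_elem (fund_circuit U \<Omega> r B \<omega> - B) = x"
proof -
  have ind: "indep U \<Omega> r B" and B: "st B" using assms(1) unfolding basis_def indep_iff by auto
  have "x \<notin> B \<inter> up \<omega>" using assms(3) up_disjoint[OF assms(2)] by blast
  then obtain C where C: "circuit U \<Omega> r C" "C \<subseteq> insert x B" "x \<in> C" "C \<subseteq> insert x (up \<omega>)"
    using circuit_min_elem_iff_spans[OF B assms(2,3)] assms(4) by blast
  have "x \<notin> B" using C(2) circuit_not_indep[OF C(1) ind] by (metis insert_absorb)
  then have "C - B = {x}" using C by blast
  moreover have "C \<subseteq> B \<union> \<omega>" using C(2) assms(3) by blast
  note fund = fund_circuit_eq[OF ind assms(2) C(1) this]
  moreover have "min_elem \<Omega> ord C = x" using min_elem_eq[OF assms(2,3) C(3,4)] .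
  moreover have "has_fund_circuit U \<Omega> r B \<omega>"
    unfolding has_fund_circuit_def using C(1) \<open>C \<subseteq> B \<union> \<omega>\<close> by blast
  ultimately show "\<omega> \<in> act U \<Omega> r ord B" "the_elem (fund_circuit U \<Omega> r B \<omega> - B) = x"
    unfolding act_def using assms(2,3) by simp_all
qed

lemma H_set_iff:
  assumes "basis U \<Omega> r B" "transversal U \<Omega> T"
  shows "T \<in> H_set U \<Omega> r ord B \<longleftrightarrow>
    (\<forall>\<omega>\<in>\<Omega>. the_elem (B \<inter> \<omega>) = the_elem (T \<inter> \<omega>) \<or> spans (B \<inter> up \<omega>) (the_elem (T \<inter> \<omega>)))"
proof
  have B: "transversal U \<Omega> B" using basis_transversal[OF assms(1)] .
  show "\<forall>\<omega>\<in>\<Omega>. the_elem (B \<inter> \<omega>) = the_elem (T \<inter> \<omega>) \<or> spans (B \<inter> up \<omega>) (the_elem (T \<inter> \<omega>))"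
    if H: "T \<in> H_set U \<Omega> r ord B"
  proof
    fix \<omega> assume w: "\<omega> \<in> \<Omega>"
    note t = transversal_the_elem[OF assms(2) w]
    consider "the_elem (T \<inter> \<omega>) \<in> B" | "the_elem (T \<inter> \<omega>) \<in> B_ext U \<Omega> r ord B"
      using H t(1) unfolding H_set_def by blast
    then show "the_elem (B \<inter> \<omega>) = the_elem (T \<inter> \<omega>) \<or> spans (B \<inter> up \<omega>) (the_elem (T \<inter> \<omega>))"
    proof cases
      case 1
      then show ?thesis using transversal_the_elem_eq[OF B w] t(2) by blast
    next
      case 2
      then obtain \<eta> where n: "\<eta> \<in> act U \<Omega> r ord B"
        and eq: "the_elem (T \<inter> \<omega>) = the_elem (fund_circuit U \<Omega> r B \<eta> - B)"
        unfolding B_ext_def by blast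
      have "\<eta> \<in> \<Omega>" using n unfolding act_def by blast
      \<comment> \<open>The external element of an active class lies in that class, so no other
        class can supply it.\<close>
      then have "\<eta> = \<omega>" using act_imp_spans(1)[OF assms(1) n] eq t(2) w class_unique by simp
      then show ?thesis using act_imp_spans(2)[OF assms(1) n] eq by simp
    qed
  qed
  assume *: "\<forall>\<omega>\<in>\<Omega>. the_elem (B \<inter> \<omega>) = the_elem (T \<inter> \<omega>) \<or> spans (B \<inter> up \<omega>) (the_elem (T \<inter> \<omega>))"
  have "B - B_int U \<Omega> r ord B \<subseteq> T"
  proof
    fix b assume b: "b \<in> B - B_int U \<Omega> r ord B"
    then obtain \<omega> where w: "\<omega> \<in> \<Omega>" "b \<in> \<omega>"
      using B Union_classes unfolding transversal_iff st_iff by blast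
    note t = transversal_the_elem[OF assms(2) w(1)]
    have eq: "the_elem (B \<inter> \<omega>) = b" using transversal_the_elem_eq[OF B w(1)] w(2) b by blast
    \<comment> \<open>A spanned element of \<open>\<omega>\<close> would make
      \<open>\<omega>\<close> active and put \<open>b\<close> into \<open>B_int\<close>; so only
      agreement of \<open>B\<close> and \<open>T\<close> remains.\<close>
    then have "\<omega> \<notin> act U \<Omega> r ord B" using b unfolding B_int_def by blast
    then have "the_elem (B \<inter> \<omega>) = the_elem (T \<inter> \<omega>)"
      using * w(1) spans_imp_act(1)[OF assms(1) w(1) t(2)] by blast
    then show "b \<in> T" using eq t(1) by simp
  qed
  moreover have "T \<subseteq> B \<union> B_ext U \<Omega> r ord B"
  proof
    fix t assume t: "t \<in> T"
    then obtain \<omega> where w: "\<omega> \<in> \<Omega>" "t \<in> \<omega>"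
      using assms(2) Union_classes unfolding transversal_iff st_iff by blast
    have eq: "the_elem (T \<inter> \<omega>) = t" using transversal_the_elem_eq[OF assms(2) w(1) t w(2)] .
    then consider "the_elem (B \<inter> \<omega>) = t" | "spans (B \<inter> up \<omega>) t" using * w(1) by auto
    then show "t \<in> B \<union> B_ext U \<Omega> r ord B"
    proof cases
      case 1
      then show ?thesis using transversal_the_elem(1)[OF B w(1)] by simp
    next
      case 2
      then show ?thesis using spans_imp_act[OF assms(1) w] unfolding B_ext_def by force
    qed
  qed
  ultimately show "T \<in> H_set U \<Omega> r ord B" using assms(2) unfolding H_set_def by blast
qed

subsection \<open>Counting\<close>

definition upclosed :: "'a set set \<Rightarrow> bool" where
  "upclosed A \<longleftrightarrow> A \<subseteq> \<Omega> \<and> (\<forall>\<omega>\<in>A. \<forall>\<eta>\<in>\<Omega>. (\<omega>, \<eta>) \<in> ord \<longrightarrow> \<eta> \<in> A)"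

text \<open>Builds a final segment of the order from the greatest class down. Removing the least
  class \<open>\<omega>\<close> of a final segment leaves exactly the classes above
  \<open>\<omega>\<close>, hence the equation for \<open>up \<omega>\<close>.\<close>

lemma upclosed_induct [consumes 1, case_names empty insert]:
  assumes "upclosed A" "P {}"
    and step: "\<And>\<omega> A. upclosed A \<Longrightarrow> \<omega> \<in> \<Omega> \<Longrightarrow> \<omega> \<notin> A \<Longrightarrow> up \<omega> = \<Union>A \<Longrightarrow> P A \<Longrightarrow> P (insert \<omega> A)"
  shows "P A"
proof -
  have "finite A" using assms(1) finite_classes finite_subset unfolding upclosed_def by blast
  then show ?thesis using assms(1)
  proof (induction A rule: finite_psubset_induct)
    case (psubset A)
    show ?case
    proof (cases "A = {}")
      case False
      have sub: "A \<subseteq> \<Omega>" using psubset.prems unfolding upclosed_def by blast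
      then obtain \<omega> where w: "\<omega> \<in> A" "\<forall>\<eta>\<in>A. \<eta> \<noteq> \<omega> \<longrightarrow> (\<omega>, \<eta>) \<in> ord"
        using least_class[OF psubset.hyps(1) False] by blast
      have "(\<eta>, \<omega>) \<notin> ord" if "\<eta> \<in> A - {\<omega>}" for \<eta>
        using ord_trans[of \<omega> \<eta> \<omega>] ord_irrefl w(2) that by blast
      then have up: "upclosed (A - {\<omega>})"
        using psubset.prems unfolding upclosed_def by blast
      have "{\<eta>\<in>\<Omega>. (\<omega>, \<eta>) \<in> ord} = A - {\<omega>}"
        using psubset.prems w ord_irrefl unfolding upclosed_def by blast
      then have "up \<omega> = \<Union>(A - {\<omega>})" unfolding up_def by simp
      moreover have "A - {\<omega>} \<subset> A" "\<omega> \<in> \<Omega>" using w(1) sub by blast+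
      ultimately have "P (insert \<omega> (A - {\<omega>}))"
        by (intro step[OF up] psubset.IH[OF _ up]) simp_all
      then show ?thesis using w by (simp add: insert_absorb)
    qed (simp add: assms(2))
  qed
qed

text \<open>The states of the top-down choice once the classes in \<open>A\<close> are settled, with
  the conditions of \<open>basis_iff\<close> and \<open>H_set_iff\<close> imposed on these classes
  only.\<close>

definition partial_bases :: "'a set \<Rightarrow> 'a set set \<Rightarrow> 'a set set" where
  "partial_bases T A = {Q. st Q \<and> Q \<subseteq> \<Union>A \<and> (\<forall>\<omega>\<in>A. Q \<inter> \<omega> \<noteq> {} \<and>
     \<not> spans (Q \<inter> up \<omega>) (the_elem (Q \<inter> \<omega>)) \<and>
     (the_elem (Q \<inter> \<omega>) = the_elem (T \<inter> \<omega>) \<or> spans (Q \<inter> up \<omega>) (the_elem (T \<inter> \<omega>))))}"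

lemma bases_eq_partial_bases:
  assumes "transversal U \<Omega> T"
  shows "{B. basis U \<Omega> r B \<and> T \<in> H_set U \<Omega> r ord B} = partial_bases T \<Omega>"
proof -
  have "st B \<Longrightarrow> B \<subseteq> \<Union>\<Omega>" for B using Union_classes unfolding st_iff by blast
  then show ?thesis
    unfolding partial_bases_def using basis_transversal H_set_iff[OF _ assms] basis_iff transversal_iff
    by (intro Collect_cong) metis
qed

text \<open>A new element in a lower class leaves the conditions for the earlier classes untouched,
  and at \<open>\<omega>\<close> the part above is the whole of \<open>Q\<close>.\<close>

lemma partial_bases_insert:
  assumes "upclosed A" "\<omega> \<in> \<Omega>" "\<omega> \<notin> A" "up \<omega> = \<Union>A"
  shows "partial_bases T (insert \<omega> A) = {insert b Q | Q b. Q \<in> partial_bases T A \<and> b \<in> \<omega> \<and>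
    \<not> spans Q b \<and> (b = the_elem (T \<inter> \<omega>) \<or> spans Q (the_elem (T \<inter> \<omega>)))}"
    (is "?L = ?R")
proof -
  have sub: "A \<subseteq> \<Omega>" using assms(1) unfolding upclosed_def by blast
  have dis: "\<omega> \<inter> \<Union>A = {}" using up_disjoint[OF assms(2)] assms(4) by blast
  have up: "up \<eta> \<subseteq> \<Union>A" if "\<eta> \<in> A" for \<eta> using assms(1) that unfolding upclosed_def up_def by blast
  have restr: "insert b Q \<inter> up \<eta> = Q \<inter> up \<eta>" "insert b Q \<inter> \<eta> = Q \<inter> \<eta>" if "b \<in> \<omega>" "\<eta> \<in> A" for b Q \<eta>
  proof -
    have "b \<notin> \<Union>A" using that(1) dis by blast
    then show "insert b Q \<inter> up \<eta> = Q \<inter> up \<eta>" "insert b Q \<inter> \<eta> = Q \<inter> \<eta>"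
      using up[OF that(2)] that(2) by blast+
  qed
  have top: "insert b Q \<inter> up \<omega> = Q" "insert b Q \<inter> \<omega> = {b}" if "b \<in> \<omega>" "Q \<subseteq> \<Union>A" for b Q
    unfolding assms(4) using that dis by blast+
  \<comment> \<open>Isolates the condition at a class as a function of the two intersections, so
    that \<open>restr\<close> and \<open>top\<close> can be applied by rewriting.\<close>
  define ok where "ok X Y \<eta> \<longleftrightarrow> X \<noteq> {} \<and> \<not> spans Y (the_elem X) \<and>
    (the_elem X = the_elem (T \<inter> \<eta>) \<or> spans Y (the_elem (T \<inter> \<eta>)))" for X Y \<eta>
  have pb: "X \<in> partial_bases T D \<longleftrightarrow> st X \<and> X \<subseteq> \<Union>D \<and> (\<forall>\<eta>\<in>D. ok (X \<inter> \<eta>) (X \<inter> up \<eta>) \<eta>)"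
    for X D unfolding partial_bases_def ok_def by simp
  have key: "insert b Q \<in> ?L \<longleftrightarrow> Q \<in> partial_bases T A \<and> \<not> spans Q b \<and>
      (b = the_elem (T \<inter> \<omega>) \<or> spans Q (the_elem (T \<inter> \<omega>)))"
    if b: "b \<in> \<omega>" and Q: "Q \<subseteq> \<Union>A" for b Q
  proof -
    have "Q \<inter> \<omega> = {}" using Q dis by blast
    then have "st (insert b Q) \<longleftrightarrow> st Q"
      using st_insert[OF _ assms(2) b] st_subset[OF _ subset_insertI] by blast
    moreover have "insert b Q \<subseteq> \<Union>(insert \<omega> A)" using b Q by blast
    moreover have "(\<forall>\<eta>\<in>A. ok (insert b Q \<inter> \<eta>) (insert b Q \<inter> up \<eta>) \<eta>) \<longleftrightarrow>
        (\<forall>\<eta>\<in>A. ok (Q \<inter> \<eta>) (Q \<inter> up \<eta>) \<eta>)"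
      by (intro ball_cong refl) (simp only: restr[OF b])
    moreover have "ok (insert b Q \<inter> \<omega>) (insert b Q \<inter> up \<omega>) \<omega> \<longleftrightarrow>
        \<not> spans Q b \<and> (b = the_elem (T \<inter> \<omega>) \<or> spans Q (the_elem (T \<inter> \<omega>)))"
      unfolding top[OF b Q] ok_def by simp
    ultimately show ?thesis unfolding pb using Q by (metis insert_iff)
  qed
  show ?thesis
  proof (intro equalityI subsetI)
    fix X assume X: "X \<in> ?L"
    then have st: "st X" and "X \<inter> \<omega> \<noteq> {}" and XA: "X \<subseteq> \<omega> \<union> \<Union>A" unfolding partial_bases_def by auto
    then obtain b where b: "b \<in> X" "b \<in> \<omega>" by blast
    then have "x = b" if "x \<in> X" "x \<in> \<omega>" for x using st_eq[OF st assms(2)] that by blast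
    then have XI: "X = insert b (X \<inter> \<Union>A)" using b XA by blast
    then have "insert b (X \<inter> \<Union>A) \<in> ?L" using X by metis
    then show "X \<in> ?R" using key[OF b(2) Int_lower2] XI b(2) by blast
  next
    fix X assume "X \<in> ?R"
    then obtain Q b where X: "X = insert b Q" "Q \<in> partial_bases T A" "b \<in> \<omega>" "\<not> spans Q b"
      "b = the_elem (T \<inter> \<omega>) \<or> spans Q (the_elem (T \<inter> \<omega>))" by blast
    moreover have "Q \<subseteq> \<Union>A" using X(2) unfolding partial_bases_def by blast
    ultimately show "X \<in> ?L" using key[of b Q] by simp
  qed
qed

text \<open>Adding \<open>S\<close> raises the rank of \<open>Q\<close> and that of the part of
  \<open>T\<close> in \<open>A\<close> by the same amount; sums avoid truncated subtraction. Both
  \<open>Q\<close> and \<open>S\<close> vary in the induction, since the step uses the hypothesis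
  for \<open>S\<close>, \<open>{t}\<close> and \<open>insert t S\<close>.\<close>

lemma partial_bases_contraction:
  assumes "upclosed A" "transversal U \<Omega> T" "Q \<in> partial_bases T A" "st S" "S \<inter> \<Union>A = {}"
  shows "r (Q \<union> S) + r (T \<inter> \<Union>A) = r ((T \<inter> \<Union>A) \<union> S) + r Q"
  using assms(1,3-5)
proof (induction A arbitrary: Q S rule: upclosed_induct)
  case empty
  then show ?case unfolding partial_bases_def by simp
next
  case (insert \<omega> A)
  define t where "t = the_elem (T \<inter> \<omega>)"
  define P where "P = T \<inter> \<Union>A"
  have t: "t \<in> T" "t \<in> \<omega>" "T \<inter> \<omega> = {t}"
    unfolding t_def using transversal_the_elem transversal_inter assms(2) insert.hyps(2) by blast+
  have P': "T \<inter> \<Union>(insert \<omega> A) = insert t P" unfolding P_def using t by blast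
  have T: "st T" using assms(2) unfolding transversal_iff by blast
  from insert.prems(1) obtain Q' b where Q: "Q = insert b Q'" "Q' \<in> partial_bases T A" "b \<in> \<omega>"
    "\<not> spans Q' b" "b = t \<or> spans Q' t"
    unfolding t_def partial_bases_insert[OF insert.hyps] by blast
  have sub: "A \<subseteq> \<Omega>" using insert.hyps(1) unfolding upclosed_def by blast
  have dis: "\<omega> \<inter> \<Union>A = {}" using up_disjoint[OF insert.hyps(2)] insert.hyps(4) by blast
  have Q': "st Q'" "Q' \<subseteq> \<Union>A" using Q(2) unfolding partial_bases_def by auto
  have S: "S \<inter> \<omega> = {}" "S \<inter> \<Union>A = {}" using insert.prems(3) by auto
  have stu: "st (R \<union> S)" if "st R" "R \<subseteq> \<Union>A" for R
  proof -
    have "x = y" if "\<eta> \<in> \<Omega>" "x \<in> R" "y \<in> S" "x \<in> \<eta>" "y \<in> \<eta>" for \<eta> x y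
      using that S(2) \<open>R \<subseteq> \<Union>A\<close> sub class_unique by blast
    then show ?thesis using that(1) insert.prems(2) unfolding st_iff by (metis Un_iff Un_subset_iff)
  qed
  have sti: "st (insert x (R \<union> S))" "st (insert x R)" if "st R" "R \<subseteq> \<Union>A" "x \<in> \<omega>" for x R
    using st_insert[OF stu[OF that(1,2)] insert.hyps(2) that(3)] st_subset that S(1) dis by blast+
  have stP: "st P" "P \<subseteq> \<Union>A" unfolding P_def using st_subset[OF T] by auto
  have IH: "r (Q' \<union> S') + r P = r (P \<union> S') + r Q'" if "st S'" "S' \<inter> \<Union>A = {}" for S'
    unfolding P_def using insert.IH[OF Q(2) that] .
  have stt: "st (insert t S)" "st {t}"
    using sti[OF stP t(2)] st_subset by (blast, blast)
  have dt: "insert t S \<inter> \<Union>A = {}" "{t} \<inter> \<Union>A = {}" using S dis t by blast+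
  have IHt: "r (insert t (Q' \<union> S)) + r P = r (insert t (P \<union> S)) + r Q'"
     "r (insert t Q') + r P = r (insert t P) + r Q'"
    using IH[OF stt(1) dt(1)] IH[OF stt(2) dt(2)] by simp_all
  have IHS: "r (Q' \<union> S) + r P = r (P \<union> S) + r Q'"
    using IH[OF insert.prems(2) S(2)] .
  \<comment> \<open>If \<open>Q'\<close> does not span \<open>t\<close>, then \<open>b = t\<close>
    and the hypothesis for \<open>insert t S\<close> and \<open>{t}\<close> suffices. Otherwise
    \<open>P\<close> spans \<open>t\<close> too, so the \<open>T\<close> side does not change, while
    on the other side both ranks grow by one.\<close>
  have "r (insert b (Q' \<union> S)) + r (insert t P) = r (insert t (P \<union> S)) + r (insert b Q')"
  proof (cases "spans Q' t")
    case False
    then show ?thesis using Q(5) IHt by simp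
  next
    case True
    have spP: "spans P t" using True IHt(2) unfolding spans_def by simp
    have spPS: "spans (P \<union> S) t" using spans_mono[OF spP] sti(1)[OF stP t(2)] by blast
    have spQS: "spans (Q' \<union> S) t" using spans_mono[OF True] sti(1)[OF Q' t(2)] by blast
    have "b \<noteq> t" using Q(4) True by blast
    moreover have "(Q' \<union> S) \<inter> \<omega> = {}" using Q'(2) dis S(1) by blast
    \<comment> \<open>Even with \<open>S\<close> added, \<open>t\<close> takes the only place for a
      spanned element of \<open>\<omega>\<close>.\<close>
    ultimately have "\<not> spans (Q' \<union> S) b"
      using spans_unique[OF stu[OF Q'] insert.hyps(2) _ Q(3) t(2)] spQS by blast
    then have "r (insert b (Q' \<union> S)) = r (Q' \<union> S) + 1"
      using spans_iff sti(1)[OF Q' Q(3)] by blast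
    moreover have "r (insert b Q') = r Q' + 1" using spans_iff sti(2)[OF Q' Q(3)] Q(4) by blast
    ultimately show ?thesis using spP spPS IHS unfolding spans_def by simp
  qed
  then show ?case unfolding P' Q(1) by simp
qed

lemma card_partial_bases:
  assumes "upclosed A" "transversal U \<Omega> T"
  shows "card (partial_bases T A) = (\<Prod>\<omega>\<in>A \<inter> mcs U \<Omega> r ord T. card \<omega> - 1)"
  using assms(1)
proof (induction A rule: upclosed_induct)
  case empty
  have "partial_bases T {} = {{}}" unfolding partial_bases_def by (auto simp: st_iff)
  then show ?case by simp
next
  case (insert \<omega> A)
  define t where "t = the_elem (T \<inter> \<omega>)"
  have t: "t \<in> T" "t \<in> \<omega>"
    unfolding t_def using transversal_the_elem assms(2) insert.hyps(2) by blast+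
  have dis: "\<omega> \<inter> \<Union>A = {}" using up_disjoint[OF insert.hyps(2)] insert.hyps(4) by blast
  have Q: "st Q" "Q \<subseteq> \<Union>A" if "Q \<in> partial_bases T A" for Q
    using that unfolding partial_bases_def by auto
  have "st {t}" using assms(2) t(1) st_subset[of T] unfolding transversal_iff by blast
  moreover have "{t} \<inter> \<Union>A = {}" using t(2) dis by blast
  ultimately have contr: "r (Q \<union> {t}) + r (T \<inter> \<Union>A) = r ((T \<inter> \<Union>A) \<union> {t}) + r Q"
    if "Q \<in> partial_bases T A" for Q
    by (rule partial_bases_contraction[OF insert.hyps(1) assms(2) that])
  \<comment> \<open>The contraction identity with \<open>S = {t}\<close>: whether \<open>t\<close>
    is spanned does not depend on the choice of \<open>Q\<close>.\<close>
  have spans_t: "spans Q t \<longleftrightarrow> \<omega> \<in> mcs U \<Omega> r ord T" if "Q \<in> partial_bases T A" for Q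
    using contr[OF that]
    unfolding mcs_iff[OF assms(2) insert.hyps(2)] t_def[symmetric] spans_def insert.hyps(4)
    by simp linarith
  \<comment> \<open>The admissible elements of \<open>\<omega>\<close>, the same set for every
    \<open>Q\<close>; the count is therefore a product.\<close>
  define D where "D = (if \<omega> \<in> mcs U \<Omega> r ord T then \<omega> - {t} else {t})"
  have D: "b \<in> D \<longleftrightarrow> b \<in> \<omega> \<and> \<not> spans Q b \<and> (b = t \<or> spans Q t)"
    if "Q \<in> partial_bases T A" for Q b
  proof -
    have "Q \<inter> \<omega> = {}" using Q(2)[OF that] dis by blast
    then have "b \<in> \<omega> \<Longrightarrow> spans Q b \<Longrightarrow> spans Q t \<Longrightarrow> b = t"
      using spans_unique[OF Q(1)[OF that] insert.hyps(2)] t(2) by blast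
    then show ?thesis using spans_t[OF that] t(2) unfolding D_def by auto
  qed
  have "(\<lambda>(Q, b). insert b Q) ` (partial_bases T A \<times> D) =
      {insert b Q | Q b. Q \<in> partial_bases T A \<and> b \<in> D}"
    by auto
  also have "\<dots> = partial_bases T (insert \<omega> A)"
    unfolding partial_bases_insert[OF insert.hyps(1-4)] t_def[symmetric]
    by (intro Collect_cong ex_cong1 conj_cong refl D)
  finally have "partial_bases T (insert \<omega> A) = (\<lambda>(Q, b). insert b Q) ` (partial_bases T A \<times> D)"
    by (rule sym)
  \<comment> \<open>The pair is recovered by intersecting \<open>insert b Q\<close> with
    \<open>\<omega>\<close> and with \<open>\<Union>A\<close>.\<close>
  moreover have "inj_on (\<lambda>(Q, b). insert b Q) (partial_bases T A \<times> D)"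
  proof (rule inj_onI, clarify)
    fix Q b Q' b' assume *: "Q \<in> partial_bases T A" "b \<in> D" "Q' \<in> partial_bases T A" "b' \<in> D"
      "insert b Q = insert b' Q'"
    have "insert b Q \<inter> \<omega> = {b} \<and> insert b Q \<inter> \<Union>A = Q" if "b \<in> \<omega>" "Q \<subseteq> \<Union>A" for b Q
      using that dis by blast
    moreover have "b \<in> \<omega>" "b' \<in> \<omega>" using D[OF *(1)] *(2,4) by blast+
    ultimately show "Q = Q' \<and> b = b'" using Q(2)[OF *(1)] Q(2)[OF *(3)] *(5) by (metis singleton_inject)
  qed
  ultimately have "card (partial_bases T (insert \<omega> A)) = card (partial_bases T A) * card D"
    by (simp add: card_image card_cartesian_product)
  moreover have "finite A" using insert.hyps(1) finite_classes finite_subset unfolding upclosed_def by blast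
  moreover have "card D = (if \<omega> \<in> mcs U \<Omega> r ord T then card \<omega> - 1 else 1)"
    unfolding D_def using t(2) by simp
  ultimately show ?case using insert.IH insert.hyps(3) by (simp add: Int_insert_left)
qed

end

theorem theorem3p11:
  fixes U :: "'a set" and \<Omega> :: "'a set set" and r :: "'a set \<Rightarrow> nat"
    and ord :: "'a set rel" and T :: "'a set"
  assumes "multimatroid U \<Omega> r"
    and "non_degenerate \<Omega>"
    and "strict_linear_order_on \<Omega> ord"
    and "transversal U \<Omega> T"
  shows "card {B. basis U \<Omega> r B \<and> T \<in> H_set U \<Omega> r ord B} =
         (\<Prod>\<omega>\<in>mcs U \<Omega> r ord T. card \<omega> - 1)"
proof -
  interpret ordered_multimatroid U \<Omega> r ord
    by unfold_locales (fact assms)+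
  have "upclosed \<Omega>" unfolding upclosed_def by blast
  moreover have "\<Omega> \<inter> mcs U \<Omega> r ord T = mcs U \<Omega> r ord T" unfolding mcs_def by blast
  ultimately show ?thesis
    using card_partial_bases assms(4) bases_eq_partial_bases by metis
qed

end
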